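(* Let $(X,\rho)$ be a complete, separable, unbounded hyperbolic metric space and let $\omega:[0,+\infty)\to[0,+\infty)$ be a continuous, concave, nonzero and nondecreasing function with $\omega(0)=0$. If $\mathcal{C}_\omega(X)$ is endowed with the topology of pointwise convergence (metrised by the complete metric $d_\Theta(f,g)=\sum_{n=1}^\infty 2^{-n}\min\{1,\rho(f(\theta_n),g(\theta_n))\}$ for a dense sequence $\{\theta_n\}$ in $X$), then there is a meagre set $\mathcal{M}\subset\mathcal{C}_\omega(X)$ such that $\omega_f=\omega$ for every $f\in\mathcal{C}_\omega(X)\setminus\mathcal{M}$.
   Context: A metric space $(X,\rho)$ has a coherent system of geodesics $\Gamma$ if $\Gamma$ is a family of isometries $\gamma:[0,\rho(x,y)]\to X$ with $\gamma(0)=x$, $\gamma(\rho(x,y))=y$ such that: (1) for all $x,y$ there is a unique $\gamma\in\Gamma$ from $x$ to $y$; (2) if $\gamma\in\Gamma$ goes from $x$ to $y$, then $t\mapsto\gamma(\rho(x,y)-t)$ is the element of $\Gamma$ from $y$ to $x$; (3) if $\gamma\in\Gamma$ goes from $x$ to $y$ and $0\le t_1\le t_2\le\rho(x,y)$, then $t\mapsto\gamma(t+t_1)$ on $[0,t_2-t_1]$ is the element of $\Gamma$ from $\gamma(t_1)$ to $\gamma(t_2)$. Write $(1-t)x\oplus ty=\gamma(t\rho(x,y))$ with $\gamma\in\Gamma$ from $x$ to $y$. $X$ is hyperbolic if $\rho((1-t)x\oplus ty,(1-t)x\oplus tz)\le t\rho(y,z)$ for all $x,y,z\in X$, $t\in[0,1]$.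 The modulus of continuity of $f:X\to X$ is $\omega_f(s)=\sup\{\rho(f(x),f(y)):\rho(x,y)\le s\}$, and $\mathcal{C}_\omega(X)$ is the set of maps $f:X\to X$ with $\omega_f\le\omega$. *)

theory Defs
  imports "HOL-Analysis.Analysis"
begin

text \<open>A coherent system of geodesics, given as the function assigning to x, y the
  unique element of the system from x to y (only its values on [0, dist x y] matter).\<close>
definition coherent_geodesics :: "('a::metric_space \<Rightarrow> 'a \<Rightarrow> real \<Rightarrow> 'a) \<Rightarrow> bool" where
  "coherent_geodesics geo \<longleftrightarrow>
     (\<forall>x y. geo x y 0 = x \<and> geo x y (dist x y) = y \<and>
        (\<forall>s\<in>{0..dist x y}. \<forall>t\<in>{0..dist x y}. dist (geo x y s) (geo x y t) = \<bar>s - t\<bar>)) \<and>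
     (\<forall>x y. \<forall>t\<in>{0..dist x y}. geo y x t = geo x y (dist x y - t)) \<and>
     (\<forall>x y t1 t2. 0 \<le> t1 \<and> t1 \<le> t2 \<and> t2 \<le> dist x y \<longrightarrow>
        (\<forall>t\<in>{0..t2 - t1}. geo (geo x y t1) (geo x y t2) t = geo x y (t + t1)))"

definition geo_comb :: "('a::metric_space \<Rightarrow> 'a \<Rightarrow> real \<Rightarrow> 'a) \<Rightarrow> 'a \<Rightarrow> 'a \<Rightarrow> real \<Rightarrow> 'a" where
  "geo_comb geo x y t = geo x y (t * dist x y)"

definition hyperbolic_geo :: "('a::metric_space \<Rightarrow> 'a \<Rightarrow> real \<Rightarrow> 'a) \<Rightarrow> bool" where
  "hyperbolic_geo geo \<longleftrightarrow>
     (\<forall>x y z. \<forall>t\<in>{0..1}. dist (geo_comb geo x y t) (geo_comb geo x z t) \<le> t * dist y z)"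

definition hyperbolic_space :: "'a::metric_space itself \<Rightarrow> bool" where
  "hyperbolic_space _ \<longleftrightarrow> (\<exists>geo::'a \<Rightarrow> 'a \<Rightarrow> real \<Rightarrow> 'a. coherent_geodesics geo \<and> hyperbolic_geo geo)"

text \<open>Modulus of continuity (extended-real valued, as the supremum may be infinite).\<close>
definition modulus_cont :: "('a::metric_space \<Rightarrow> 'a) \<Rightarrow> real \<Rightarrow> ereal" where
  "modulus_cont f s = (SUP p \<in> {(x, y). dist x y \<le> s}. ereal (dist (f (fst p)) (f (snd p))))"

definition C_omega :: "(real \<Rightarrow> real) \<Rightarrow> ('a::metric_space \<Rightarrow> 'a) set" where
  "C_omega \<omega> = {f. \<forall>s\<ge>0. modulus_cont f s \<le> ereal (\<omega> s)}"

definition pointwise_top :: "('a::metric_space \<Rightarrow> 'a) topology" where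
  "pointwise_top = product_topology (\<lambda>_. euclidean) UNIV"

definition nowhere_dense_in :: "'b topology \<Rightarrow> 'b set \<Rightarrow> bool" where
  "nowhere_dense_in T S \<longleftrightarrow> S \<subseteq> topspace T \<and> T interior_of (T closure_of S) = {}"

definition meagre_in :: "'b topology \<Rightarrow> 'b set \<Rightarrow> bool" where
  "meagre_in T M \<longleftrightarrow> M \<subseteq> topspace T \<and>
     (\<exists>F. countable F \<and> (\<forall>S\<in>F. nowhere_dense_in T S) \<and> M \<subseteq> \<Union>F)"

end

theory Submission
  imports Defs
begin

text \<open>
  Fix \<open>s > 0\<close>. The maps whose modulus at \<open>s\<close> stays a fixed amount below \<open>\<omega> s\<close> form a
  closed set, and it has empty interior because every \<open>f\<close> can be perturbed as follows.
  Put \<open>p = f x\<^sub>0\<close> and slide \<open>f x\<close> along the geodesic towards \<open>p\<close> by the proportion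
  \<open>min 1 (c * dist x x\<^sub>0)\<close>. By concavity the result is still in the class; it is close to
  \<open>f\<close> on bounded sets if \<open>c\<close> is small, and it is constantly \<open>p\<close> far from \<open>x\<^sub>0\<close>. There one
  can insert a bump \<open>y \<mapsto> max 0 (T - \<omega> (dist y u))\<close> with values on a geodesic from \<open>p\<close> to
  some \<open>w\<close>, where \<open>T\<close> is almost \<open>\<omega> s\<close>.

  If \<open>\<omega>\<close> is unbounded, the interaction of the bump with the rest is harmless as soon as the
  bump is far enough away. If \<open>\<omega>\<close> has a finite supremum \<open>L\<close>, all values must stay at distance
  at most \<open>L\<close> from each other. One first contracts \<open>f\<close> a little, so that its range has
  diameter less than \<open>L\<close>, and then uses the intermediate value theorem on a long geodesic to
  find \<open>w\<close> whose distances to the range have supremum just below \<open>L\<close>; the base point \<open>x\<^sub>0\<close> is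
  chosen such that \<open>dist (f x\<^sub>0) w\<close> almost attains this supremum.
\<close>

lemma modulus_cont_mono: "s \<le> t \<Longrightarrow> modulus_cont f s \<le> modulus_cont f t"
  unfolding modulus_cont_def by (intro SUP_subset_mono) auto

section \<open>Elementary inequalities for a concave modulus\<close>

locale concave_modulus =
  fixes \<omega> :: "real \<Rightarrow> real"
  assumes nonneg: "0 \<le> s \<Longrightarrow> 0 \<le> \<omega> s"
    and zero: "\<omega> 0 = 0"
    and concave: "concave_on {0..} \<omega>"
    and mono: "0 \<le> s \<Longrightarrow> s \<le> t \<Longrightarrow> \<omega> s \<le> \<omega> t"
begin

text \<open>Concavity on the segment from \<open>0\<close> to \<open>b\<close>, together with
  \<open>\<omega> 0 = 0\<close>, makes the slope \<open>\<omega> a / a\<close> nonincreasing. The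
  multiplied-out form also covers \<open>0\<close>.\<close>

lemma slope_decreasing:
  assumes "0 \<le> a" "a \<le> b"
  shows "a * \<omega> b \<le> b * \<omega> a"
proof (cases "b = 0")
  case False
  with assms have b: "b > 0" by simp
  have "a / b * \<omega> b + (1 - a / b) * \<omega> 0 \<le> \<omega> (a / b * b + (1 - a / b) * 0)"
    using concave_onD[OF concave, of "a / b" 0 b] assms b
    by (simp add: algebra_simps)
  then have "a / b * \<omega> b \<le> \<omega> a"
    using b zero by simp
  then show ?thesis
    using b by (simp add: field_simps)
qed (use assms in simp)

lemma subadditive:
  assumes "0 \<le> a" "0 \<le> b"
  shows "\<omega> (a + b) \<le> \<omega> a + \<omega> b"
proof (cases "a + b = 0")
  case True
  then show ?thesis using assms zero by (simp add: add_nonneg_eq_0_iff)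
next
  case False
  have "a * \<omega> (a + b) \<le> (a + b) * \<omega> a" "b * \<omega> (a + b) \<le> (a + b) * \<omega> b"
    using slope_decreasing[of a "a + b"] slope_decreasing[of b "a + b"] assms by auto
  then have "(a + b) * \<omega> (a + b) \<le> (a + b) * (\<omega> a + \<omega> b)"
    by (simp add: algebra_simps)
  then show ?thesis
    using False assms by simp
qed

lemma abs_diff_le:
  assumes "0 \<le> a" "0 \<le> b"
  shows "\<bar>\<omega> a - \<omega> b\<bar> \<le> \<omega> \<bar>a - b\<bar>"
proof (cases "a \<le> b")
  case True
  then show ?thesis
    using subadditive[of a "b - a"] mono[of a b] assms by simp
next
  case False
  then show ?thesis
    using subadditive[of b "a - b"] mono[of b a] assms by simp
qed

text \<open>Testing the supremum at \<open>s = dist x y\<close> gives one direction, monotonicity of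
  \<open>\<omega>\<close> the other. This removes extended reals from membership proofs.\<close>

lemma C_omega_iff: "f \<in> C_omega \<omega> \<longleftrightarrow> (\<forall>x y. dist (f x) (f y) \<le> \<omega> (dist x y))"
  unfolding C_omega_def modulus_cont_def
  by (fastforce simp: SUP_le_iff intro: order_trans[OF _ mono])

end

section \<open>Convexity of the metric along the chosen geodesics\<close>

locale hyperbolic_geodesics =
  fixes geo :: "'a::metric_space \<Rightarrow> 'a \<Rightarrow> real \<Rightarrow> 'a"
  assumes coherent: "coherent_geodesics geo"
    and hyperbolic: "hyperbolic_geo geo"
begin

lemma geo_0 [simp]: "geo x y 0 = x"
  and geo_dist [simp]: "geo x y (dist x y) = y"
  using coherent unfolding coherent_geodesics_def by blast+

lemma dist_geo:
  "0 \<le> s \<Longrightarrow> s \<le> dist x y \<Longrightarrow> 0 \<le> t \<Longrightarrow> t \<le> dist x y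
    \<Longrightarrow> dist (geo x y s) (geo x y t) = \<bar>s - t\<bar>"
  using coherent unfolding coherent_geodesics_def by auto

lemma geo_comb_0 [simp]: "geo_comb geo x y 0 = x"
  and geo_comb_1 [simp]: "geo_comb geo x y 1 = y"
  by (simp_all add: geo_comb_def)

lemma dist_geo_comb:
  assumes "0 \<le> s" "s \<le> 1" "0 \<le> t" "t \<le> 1"
  shows "dist (geo_comb geo x y s) (geo_comb geo x y t) = \<bar>s - t\<bar> * dist x y"
proof -
  have "dist (geo_comb geo x y s) (geo_comb geo x y t) = \<bar>s * dist x y - t * dist x y\<bar>"
    unfolding geo_comb_def by (rule dist_geo) (use assms in \<open>auto simp: mult_left_le_one_le\<close>)
  then show ?thesis
    by (simp add: left_diff_distrib[symmetric] abs_mult)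
qed

lemma dist_geo_comb_le:
  "0 \<le> t \<Longrightarrow> t \<le> 1 \<Longrightarrow> dist (geo_comb geo x y t) (geo_comb geo x z t) \<le> t * dist y z"
  using hyperbolic unfolding hyperbolic_geo_def by auto

text \<open>The point with parameter \<open>t\<close> on the geodesic from \<open>x\<close> to
  \<open>k\<close> is at distance exactly \<open>(1 - t) * dist k x\<close> from \<open>k\<close>;
  hyperbolicity compares it with the point on the geodesic to \<open>y\<close>.\<close>

lemma dist_geo_comb_convex:
  assumes "0 \<le> t" "t \<le> 1"
  shows "dist k (geo_comb geo x y t) \<le> (1 - t) * dist k x + t * dist k y"
proof -
  have "dist k (geo_comb geo x k t) = (1 - t) * dist k x"
    using dist_geo_comb[of 1 t x k] assms by (simp add: dist_commute)
  moreover have "dist (geo_comb geo x k t) (geo_comb geo x y t) \<le> t * dist k y"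
    using dist_geo_comb_le assms by blast
  ultimately show ?thesis
    using dist_triangle[of k "geo_comb geo x y t" "geo_comb geo x k t"] by linarith
qed

lemma dist_geo_comb_le_bound:
  assumes "0 \<le> t" "t \<le> 1" "dist k x \<le> B" "dist k y \<le> B"
  shows "dist k (geo_comb geo x y t) \<le> B"
  using dist_geo_comb_convex[OF assms(1,2), of k x y] assms
    convex_bound_le[of "dist k x" B "dist k y" "1 - t" t] by simp

text \<open>Geodesic convexity of balls, in the arc-length parametrisation that the bumps
  use.\<close>

lemma dist_geo_le_bound:
  assumes "0 \<le> t" "t \<le> dist x y" "dist k x \<le> B" "dist k y \<le> B"
  shows "dist k (geo x y t) \<le> B"
proof (cases "dist x y = 0")
  case False
  have "geo x y t = geo_comb geo x y (t / dist x y)"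
    using False by (simp add: geo_comb_def)
  then show ?thesis
    using dist_geo_comb_le_bound[of "t / dist x y" k x B y] assms False by (simp add: divide_simps)
qed (use assms in simp)

end

lemma unbounded_UNIV_far:
  fixes x :: "'a::metric_space"
  assumes "\<not> bounded (UNIV :: 'a set)"
  obtains z where "r \<le> dist x z"
proof -
  have "\<exists>z. \<not> dist x z \<le> r"
    using assms unfolding bounded_def by auto
  then show thesis
    using that by (meson nle_le)
qed

locale hyperbolic_modulus = concave_modulus \<omega> + hyperbolic_geodesics geo
  for \<omega> :: "real \<Rightarrow> real" and geo :: "'a::metric_space \<Rightarrow> 'a \<Rightarrow> real \<Rightarrow> 'a" +
  assumes unbounded: "\<not> bounded (UNIV :: 'a set)"
begin

section \<open>Tapering a map to a constant, and inserting a bump\<close>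

definition taper :: "real \<Rightarrow> 'a \<Rightarrow> ('a \<Rightarrow> 'a) \<Rightarrow> 'a \<Rightarrow> 'a" where
  "taper c x0 f x = geo_comb geo (f x0) (f x) (1 - min 1 (c * dist x x0))"

text \<open>The comparison point lies on the geodesic to \<open>f y\<close> but has the parameter
  belonging to \<open>x\<close>. Hyperbolicity puts it within
  \<open>(1 - \<Lambda> a) * \<omega> (dist x y)\<close> of the value at \<open>x\<close>; the
  change of parameter costs at most \<open>(\<Lambda> a - \<Lambda> b) * \<omega> b\<close>, which
  the slope inequalities bound by the remaining
  \<open>\<Lambda> a * \<omega> (dist x y)\<close>.\<close>

lemma taper_in_C_omega:
  assumes f: "f \<in> C_omega \<omega>" and c: "0 < c"
  shows "taper c x0 f \<in> C_omega \<omega>"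
proof -
  define \<Lambda> where "\<Lambda> a = min 1 (c * a)" for a :: real
  have f': "dist (f x) (f y) \<le> \<omega> (dist x y)" for x y
    using f by (simp add: C_omega_iff)
  have le: "dist (taper c x0 f x) (taper c x0 f y) \<le> \<omega> (dist x y)"
    if ba: "dist y x0 \<le> dist x x0" for x y
  proof (cases "dist x x0 = 0")
    case True
    then show ?thesis using ba nonneg by simp
  next
    case False
    define a b where "a = dist x x0" and "b = dist y x0"
    have ab: "0 \<le> b" "b \<le> a" "0 < a"
      using ba False by (auto simp: a_def b_def)
    have \<Lambda>: "0 \<le> \<Lambda> a" "\<Lambda> a \<le> 1" "0 \<le> \<Lambda> b" "\<Lambda> b \<le> 1" "\<Lambda> b \<le> \<Lambda> a"
      using ab c by (auto simp: \<Lambda>_def min_le_iff_disj)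
    have r: "a - b \<le> dist x y"
      using dist_triangle[of x x0 y] by (simp add: a_def b_def)
    \<comment> \<open>\<open>\<Lambda>\<close> is concave and vanishes at \<open>0\<close>, so its
      slope from the origin decreases as well.\<close>
    have "b * \<Lambda> a \<le> a * \<Lambda> b"
    proof (cases "c * b \<le> 1")
      case True
      then have "a * \<Lambda> b = b * (c * a)" by (simp add: \<Lambda>_def)
      then show ?thesis
        using mult_left_mono[of "\<Lambda> a" "c * a" b] ab by (simp add: \<Lambda>_def mult_ac)
    next
      case False
      then have "\<Lambda> b = 1" by (simp add: \<Lambda>_def)
      then show ?thesis
        using ab \<Lambda> mult_mono[of b a "\<Lambda> a" 1] by simp
    qed
    then have 1: "a * (\<Lambda> a - \<Lambda> b) \<le> \<Lambda> a * (a - b)"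
      by (simp add: algebra_simps)
    have "(a - b) * \<omega> b \<le> (a - b) * \<omega> a"
      using mono[of b a] ab by (intro mult_left_mono) auto
    also have "\<dots> \<le> a * \<omega> (a - b)"
      using slope_decreasing[of "a - b" a] ab by simp
    also have "\<dots> \<le> a * \<omega> (dist x y)"
      using mono[of "a - b" "dist x y"] r ab by (intro mult_left_mono) auto
    finally have 2: "(a - b) * \<omega> b \<le> a * \<omega> (dist x y)" .
    have "a * ((\<Lambda> a - \<Lambda> b) * \<omega> b) \<le> \<Lambda> a * (a - b) * \<omega> b"
      using mult_right_mono[OF 1 nonneg[OF ab(1)]] by (simp add: mult.assoc)
    also have "\<dots> \<le> a * (\<Lambda> a * \<omega> (dist x y))"
      using mult_left_mono[OF 2 \<Lambda>(1)] by (simp add: algebra_simps)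
    finally have key: "(\<Lambda> a - \<Lambda> b) * \<omega> b \<le> \<Lambda> a * \<omega> (dist x y)"
      using ab by simp
    have "dist (taper c x0 f x) (geo_comb geo (f x0) (f y) (1 - \<Lambda> a)) \<le> (1 - \<Lambda> a) * dist (f x) (f y)"
      unfolding taper_def a_def[symmetric] \<Lambda>_def[symmetric]
      using \<Lambda> by (intro dist_geo_comb_le) auto
    also have "\<dots> \<le> (1 - \<Lambda> a) * \<omega> (dist x y)"
      using f' \<Lambda> by (intro mult_left_mono) auto
    finally have 3: "dist (taper c x0 f x) (geo_comb geo (f x0) (f y) (1 - \<Lambda> a))
        \<le> (1 - \<Lambda> a) * \<omega> (dist x y)" .
    have "dist (geo_comb geo (f x0) (f y) (1 - \<Lambda> a)) (taper c x0 f y) = (\<Lambda> a - \<Lambda> b) * dist (f x0) (f y)"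
      unfolding taper_def b_def[symmetric] \<Lambda>_def[symmetric]
      using \<Lambda> by (subst dist_geo_comb) auto
    also have "\<dots> \<le> (\<Lambda> a - \<Lambda> b) * \<omega> b"
      using f'[of x0 y] \<Lambda> by (intro mult_left_mono) (auto simp: b_def dist_commute)
    also note key
    finally show ?thesis
      using 3 dist_triangle[of "taper c x0 f x" "taper c x0 f y" "geo_comb geo (f x0) (f y) (1 - \<Lambda> a)"]
      by (simp add: algebra_simps)
  qed
  show ?thesis
    unfolding C_omega_iff
  proof (intro allI)
    fix x y
    show "dist (taper c x0 f x) (taper c x0 f y) \<le> \<omega> (dist x y)"
      using le[of x y] le[of y x] by (cases "dist y x0 \<le> dist x x0") (auto simp: dist_commute)
  qed
qed

lemma taper_far: "0 < c \<Longrightarrow> 1 / c \<le> dist x x0 \<Longrightarrow> taper c x0 f x = f x0"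
  by (simp add: taper_def field_simps)

lemma dist_taper_le:
  assumes "0 < c"
  shows "dist (taper c x0 f x) (f x) \<le> c * dist x x0 * dist (f x0) (f x)"
proof -
  have "dist (taper c x0 f x) (f x) = min 1 (c * dist x x0) * dist (f x0) (f x)"
    using dist_geo_comb[of "1 - min 1 (c * dist x x0)" 1 "f x0" "f x"] assms
    by (simp add: taper_def min_le_iff_disj)
  also have "\<dots> \<le> c * dist x x0 * dist (f x0) (f x)"
    by (intro mult_right_mono) auto
  finally show ?thesis .
qed

lemma dist_taper_le_bound:
  assumes "0 < c" "dist k (f x0) \<le> B" "dist k (f x) \<le> B"
  shows "dist k (taper c x0 f x) \<le> B"
  unfolding taper_def using assms by (intro dist_geo_comb_le_bound) (auto simp: min_le_iff_disj)

text \<open>Outside the ball of radius \<open>R\<close> the constant \<open>p\<close> is replaced by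
  a bump around a remote \<open>u\<close>. The bump alone respects \<open>\<omega>\<close> by
  \<open>abs_diff_le\<close>. Against points of the ball only its nonzero part matters, and that is
  at least \<open>r\<close> away, so \<open>B \<le> \<omega> r\<close> suffices.\<close>

lemma bump_exists:
  assumes h: "h \<in> C_omega \<omega>" and far: "\<And>x. R \<le> dist x x0 \<Longrightarrow> h x = p"
    and s: "0 \<le> s" and T: "0 \<le> T" "T \<le> dist p w" "T \<le> \<omega> s"
    and B: "\<And>x \<tau>. dist x x0 < R \<Longrightarrow> 0 \<le> \<tau> \<Longrightarrow> \<tau> \<le> T \<Longrightarrow> dist (h x) (geo p w \<tau>) \<le> B"
    and r: "0 \<le> r" "B \<le> \<omega> r"
  obtains g u v where "g \<in> C_omega \<omega>" "\<And>x. dist x x0 < R \<Longrightarrow> g x = h x"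
    "dist u v = s" "dist (g u) (g v) = T"
proof -
  \<comment> \<open>The bump vanishes at distance \<open>s\<close> from \<open>u\<close> and beyond,
    which leaves a gap of at least \<open>r\<close> to the ball. The sign of \<open>R\<close> is not
    assumed, hence the absolute value.\<close>
  obtain u where u: "\<bar>R\<bar> + r + s \<le> dist x0 u"
    using unbounded_UNIV_far[OF unbounded] .
  \<comment> \<open>The geodesic towards \<open>x0\<close> supplies a point at distance exactly
    \<open>s\<close> from \<open>u\<close>, where the bump is already \<open>0\<close> because
    \<open>T \<le> \<omega> s\<close>.\<close>
  define v where "v = geo u x0 s"
  define \<phi> where "\<phi> y = max 0 (T - \<omega> (dist y u))" for y
  define g where "g x = (if dist x x0 < R then h x else geo p w (\<phi> x))" for x
  have \<phi>: "0 \<le> \<phi> y" "\<phi> y \<le> T" for y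
    using T nonneg[of "dist y u"] by (auto simp: \<phi>_def)
  have \<phi>_diff: "\<bar>\<phi> x - \<phi> y\<bar> \<le> \<omega> (dist x y)" for x y
  proof -
    have "\<bar>\<phi> x - \<phi> y\<bar> \<le> \<bar>\<omega> (dist x u) - \<omega> (dist y u)\<bar>"
      by (auto simp: \<phi>_def)
    also have "\<dots> \<le> \<omega> \<bar>dist x u - dist y u\<bar>"
      by (rule abs_diff_le) auto
    also have "\<dots> \<le> \<omega> (dist x y)"
      by (rule mono) (use abs_dist_diff_le[of x u y] in \<open>simp_all add: dist_commute\<close>)
    finally show ?thesis .
  qed
  have uv: "dist u v = s"
    using dist_geo[of 0 u x0 s] u s r by (simp add: v_def dist_commute)
  have mixed: "dist (g x) (g y) \<le> \<omega> (dist x y)" if x: "dist x x0 < R" and y: "\<not> dist y x0 < R" for x y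
  proof (cases "\<phi> y = 0")
    case True
    then have "g x = h x" "g y = h y"
      using x y far by (auto simp: g_def)
    then show ?thesis using h by (simp add: C_omega_iff)
  next
    case False
    then have "\<omega> (dist y u) < T" by (auto simp: \<phi>_def split: if_splits)
    then have "dist y u < s"
      using T mono[of s "dist y u"] s by force
    then have "r \<le> dist x y"
      using u x dist_triangle[of x0 u x] dist_triangle[of x u y] by (simp add: dist_commute)
    then have "\<omega> r \<le> \<omega> (dist x y)" using mono r by blast
    then show ?thesis
      using B[OF x \<phi>[of y]] r x y by (simp add: g_def)
  qed
  have "dist (g x) (g y) \<le> \<omega> (dist x y)" for x y
  proof -
    consider "dist x x0 < R" "dist y x0 < R" | "dist x x0 < R" "\<not> dist y x0 < R"
      | "\<not> dist x x0 < R" "dist y x0 < R" | "\<not> dist x x0 < R" "\<not> dist y x0 < R" by blast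
    then show ?thesis
    proof cases
      case 1
      then show ?thesis using h by (simp add: g_def C_omega_iff)
    next
      case 2
      then show ?thesis using mixed by blast
    next
      case 3
      then show ?thesis using mixed[of y x] by (simp add: dist_commute)
    next
      case 4
      then show ?thesis
        using dist_geo[of "\<phi> x" p w "\<phi> y"] \<phi>[of x] \<phi>[of y] T \<phi>_diff[of x y] by (simp add: g_def)
    qed
  qed
  then have "g \<in> C_omega \<omega>" by (simp add: C_omega_iff)
  moreover have "dist (g u) (g v) = T"
  proof -
    have "\<phi> u = T" "\<phi> v = 0"
      using T zero uv by (auto simp: \<phi>_def dist_commute)
    moreover have "R \<le> dist u x0" "R \<le> dist v x0"
      using u s r uv dist_triangle[of u x0 v] by (auto simp: dist_commute)
    ultimately show ?thesis
      using dist_geo[of T p w 0] T by (simp add: g_def)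
  qed
  ultimately show thesis
    using that[of g u v] uv by (simp add: g_def)
qed

section \<open>Perturbations that are small on a finite set\<close>

lemma taper_param_exists:
  assumes "finite F" "0 < \<delta>"
  obtains c where "0 < c" "\<And>x. x \<in> F \<Longrightarrow> dist x x0 < 1 / c"
    "\<And>x. x \<in> F \<Longrightarrow> dist (taper c x0 f x) (f x) < \<delta>"
proof -
  define S where "S = (\<Sum>x\<in>F. dist x x0 + dist x x0 * dist (f x0) (f x))"
  have S: "dist x x0 + dist x x0 * dist (f x0) (f x) \<le> S" if "x \<in> F" for x
    unfolding S_def using assms that by (intro member_le_sum) auto
  have S0: "0 \<le> S" unfolding S_def by (intro sum_nonneg) auto
  \<comment> \<open>\<open>S\<close> dominates the relevant quantities at all points of
    \<open>F\<close> at once; \<open>S + 1\<close> avoids division by zero and makes the resulting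
    inequalities strict.\<close>
  define c where "c = min 1 \<delta> / (S + 1)"
  have c: "0 < c" "c * S < 1" "c * S < \<delta>"
  proof -
    show "0 < c" using S0 assms by (simp add: c_def)
    moreover have "c * (S + 1) = min 1 \<delta>" using S0 by (simp add: c_def)
    ultimately show "c * S < 1" "c * S < \<delta>" by (auto simp: algebra_simps)
  qed
  show thesis
  proof
    show "0 < c" by fact
    fix x assume x: "x \<in> F"
    have "dist x x0 \<le> S" "dist x x0 * dist (f x0) (f x) \<le> S"
      using S[OF x] zero_le_dist[of x x0]
        mult_nonneg_nonneg[OF zero_le_dist[of x x0] zero_le_dist[of "f x0" "f x"]]
      by linarith+
    then have "c * dist x x0 \<le> c * S" "c * (dist x x0 * dist (f x0) (f x)) \<le> c * S"
      using c by (auto intro: mult_left_mono)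
    then have "c * dist x x0 < 1" "c * dist x x0 * dist (f x0) (f x) < \<delta>"
      using c unfolding mult.assoc by linarith+
    then show "dist x x0 < 1 / c" "dist (taper c x0 f x) (f x) < \<delta>"
      using c le_less_trans[OF dist_taper_le[OF c(1), of x0 f x]] by (auto simp: field_simps)
  qed
qed

text \<open>Here some \<open>\<omega> r\<close> exceeds the distance from \<open>p\<close> to the
  values on the ball plus the height of the bump, so the full height \<open>\<omega> s\<close> is
  available without loss.\<close>

lemma perturbation_unbounded:
  fixes f :: "'a \<Rightarrow> 'a"
  assumes \<omega>: "\<And>b. \<exists>r\<ge>0. b \<le> \<omega> r"
    and f: "f \<in> C_omega \<omega>" and F: "finite F" and \<delta>: "0 < \<delta>" and s: "0 \<le> s"
  obtains g u v where "g \<in> C_omega \<omega>" "\<And>x. x \<in> F \<Longrightarrow> dist (g x) (f x) < \<delta>"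
    "dist u v \<le> s" "\<omega> s \<le> dist (g u) (g v)"
proof -
  \<comment> \<open>Any base point works in this case.\<close>
  define x0 :: 'a where "x0 = undefined"
  obtain c where c: "0 < c" "\<And>x. x \<in> F \<Longrightarrow> dist x x0 < 1 / c"
      "\<And>x. x \<in> F \<Longrightarrow> dist (taper c x0 f x) (f x) < \<delta>"
    by (rule taper_param_exists[OF F \<delta>, of x0 f]) (rule that)
  define p where "p = f x0"
  define h where "h = taper c x0 f"
  obtain w where w: "\<omega> s \<le> dist p w"
    using unbounded_UNIV_far[OF unbounded] .
  obtain r where r: "0 \<le> r" "\<omega> (1 / c) + \<omega> s \<le> \<omega> r"
    using \<omega> by blast
  have h: "h \<in> C_omega \<omega>"
    unfolding h_def using taper_in_C_omega[OF f c(1)] .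
  have far: "h x = p" if "1 / c \<le> dist x x0" for x
    unfolding h_def p_def using taper_far[OF c(1) that] .
  have hp: "h x0 = p" by (simp add: h_def taper_def p_def)
  have B: "dist (h x) (geo p w \<tau>) \<le> \<omega> (1 / c) + \<omega> s"
    if "dist x x0 < 1 / c" "0 \<le> \<tau>" "\<tau> \<le> \<omega> s" for x \<tau>
  proof -
    have "dist (h x) p \<le> \<omega> (dist x x0)"
      using h hp unfolding C_omega_iff by metis
    also have "\<dots> \<le> \<omega> (1 / c)"
      using that by (intro mono) auto
    finally show ?thesis
      using dist_triangle[of "h x" "geo p w \<tau>" p] dist_geo[of 0 p w \<tau>] that w by simp
  qed
  obtain g u v where "g \<in> C_omega \<omega>" "\<And>x. dist x x0 < 1 / c \<Longrightarrow> g x = h x"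
    "dist u v = s" "dist (g u) (g v) = \<omega> s"
    by (rule bump_exists[where R = "1 / c" and ?x0.0 = x0, OF h far s nonneg[OF s] w order_refl B r])
      (assumption | rule that)+
  then show thesis
    using that[of g u v] c by (simp add: h_def)
qed

text \<open>The supremum \<open>\<psi> w\<close> of the distances from \<open>w\<close> to the range
  is 1-Lipschitz in \<open>w\<close>, at most \<open>D\<close> on the range and at least
  \<open>l\<close> far away, so it takes the value \<open>l\<close> on a geodesic joining such
  points.\<close>

lemma farthest_distance_exists:
  assumes diam: "\<And>x y. dist (f x) (f y :: 'a) \<le> D" and "D \<le> l"
  obtains w where "\<And>x. dist (f x) w \<le> l" "\<And>\<eta>. 0 < \<eta> \<Longrightarrow> \<exists>x. l - \<eta> < dist (f x) w"
proof -
  define \<psi> where "\<psi> w = (SUP x. dist (f x) w)" for w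
  define q where "q = f undefined"
  have bdd: "bdd_above (range (\<lambda>x. dist (f x) w))" for w
  proof (rule bdd_aboveI2)
    fix x show "dist (f x) w \<le> D + dist q w"
      using diam[of x undefined] dist_triangle[of "f x" w q] by (simp add: q_def)
  qed
  have \<psi>: "dist (f x) w \<le> \<psi> w" for x w
    unfolding \<psi>_def using bdd by (rule cSUP_upper2) auto
  have lip: "\<psi> w \<le> \<psi> w' + dist w w'" for w w'
    unfolding \<psi>_def[of w]
  proof (rule cSUP_least)
    fix x show "dist (f x) w \<le> \<psi> w' + dist w w'"
      using \<psi>[of x w'] dist_triangle[of "f x" w w'] by (simp add: dist_commute)
  qed simp
  obtain z where z: "l \<le> dist q z"
    using unbounded_UNIV_far[OF unbounded] .
  have "continuous_on {0..dist q z} (\<lambda>t. \<psi> (geo q z t))"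
  proof (rule continuous_onI)
    fix t e :: real assume t: "t \<in> {0..dist q z}" and e: "0 < e"
    have "dist (\<psi> (geo q z t')) (\<psi> (geo q z t)) \<le> e"
      if "t' \<in> {0..dist q z}" "dist t' t < e" for t'
      using lip[of "geo q z t'" "geo q z t"] lip[of "geo q z t" "geo q z t'"]
        dist_geo[of t q z t'] dist_geo[of t' q z t] t that
      by (auto simp: dist_real_def)
    then show "\<exists>d>0. \<forall>x'\<in>{0..dist q z}. dist x' t < d \<longrightarrow> dist (\<psi> (geo q z x')) (\<psi> (geo q z t)) \<le> e"
      using e by blast
  qed
  moreover have "\<psi> (geo q z 0) \<le> l"
    unfolding \<psi>_def using assms by (intro cSUP_least) (auto simp: q_def intro: order_trans)
  moreover have "l \<le> \<psi> (geo q z (dist q z))"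
    using z \<psi>[of undefined z] by (simp add: q_def)
  ultimately obtain t where t: "\<psi> (geo q z t) = l"
    using IVT'[of "\<lambda>t. \<psi> (geo q z t)" 0 l "dist q z"] by auto
  show thesis
  proof (rule that[of "geo q z t"])
    show "dist (f x) (geo q z t) \<le> l" for x
      using \<psi> t by metis
    show "\<exists>x. l - \<eta> < dist (f x) (geo q z t)" if "0 < \<eta>" for \<eta>
      using less_cSUP_iff[OF _ bdd[of "geo q z t"], of "l - \<eta>"] t that by (auto simp: \<psi>_def)
  qed
qed

text \<open>Sliding every value by the proportion \<open>t\<close> towards one point
  \<open>q\<close> shrinks distances by the factor \<open>1 - t\<close>, by hyperbolicity, and moves
  \<open>f x\<close> by only \<open>t * dist q (f x)\<close>.\<close>

lemma contraction_exists:
  fixes f :: "'a \<Rightarrow> 'a"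
  assumes f: "f \<in> C_omega \<omega>" and F: "finite F" and \<delta>: "0 < \<delta>"
  obtains g t where "0 < t" "t < 1" "\<And>x y. dist (g x) (g y) \<le> (1 - t) * \<omega> (dist x y)"
    "\<And>x. x \<in> F \<Longrightarrow> dist (g x) (f x) < \<delta>"
proof -
  define q where "q = f undefined"
  define S where "S = (\<Sum>x\<in>F. dist q (f x))"
  have S: "dist q (f x) \<le> S" if "x \<in> F" for x
    unfolding S_def using F that by (intro member_le_sum) auto
  have S0: "0 \<le> S" unfolding S_def by (intro sum_nonneg) auto
  define t where "t = min (1 / 2) (\<delta> / (S + 1))"
  have "t \<le> \<delta> / (S + 1)" by (simp add: t_def)
  then have "t * (S + 1) \<le> \<delta>" using S0 by (simp add: field_simps)
  moreover have t: "0 < t" "t < 1"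
    using \<delta> S0 by (auto simp: t_def)
  ultimately have tS: "t * S < \<delta>" by (simp add: algebra_simps)
  show thesis
  proof (rule that[OF t])
    fix x y
    have "dist (geo_comb geo q (f x) (1 - t)) (geo_comb geo q (f y) (1 - t)) \<le> (1 - t) * dist (f x) (f y)"
      using t by (intro dist_geo_comb_le) auto
    also have "\<dots> \<le> (1 - t) * \<omega> (dist x y)"
      using f t by (intro mult_left_mono) (auto simp: C_omega_iff)
    finally show "dist (geo_comb geo q (f x) (1 - t)) (geo_comb geo q (f y) (1 - t)) \<le> \<dots>" .
  next
    fix x assume "x \<in> F"
    then have "t * dist q (f x) \<le> t * S" using S t by (intro mult_left_mono) auto
    moreover have "dist (geo_comb geo q (f x) (1 - t)) (f x) = t * dist q (f x)"
      using dist_geo_comb[of "1 - t" 1 q "f x"] t by simp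
    ultimately show "dist (geo_comb geo q (f x) (1 - t)) (f x) < \<delta>"
      using tS by linarith
  qed
qed

lemma perturbation_bounded:
  fixes f :: "'a \<Rightarrow> 'a"
  assumes bdd: "bdd_above (\<omega> ` {0..})" and pos: "0 < \<omega> s"
    and f: "f \<in> C_omega \<omega>" and F: "finite F" and \<delta>: "0 < \<delta>" and s: "0 \<le> s" and \<epsilon>: "0 < \<epsilon>"
  obtains g u v where "g \<in> C_omega \<omega>" "\<And>x. x \<in> F \<Longrightarrow> dist (g x) (f x) < \<delta>"
    "dist u v \<le> s" "\<omega> s - \<epsilon> < dist (g u) (g v)"
proof -
  define L where "L = (SUP r\<in>{0..}. \<omega> r)"
  have L: "\<omega> r \<le> L" if "0 \<le> r" for r
    unfolding L_def using bdd that by (intro cSUP_upper) auto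
  have L0: "0 < L" using L[OF s] pos by simp
  obtain f1 t where t: "0 < t" "t < 1"
    and f1: "\<And>x y. dist (f1 x) (f1 y) \<le> (1 - t) * \<omega> (dist x y)"
    and f1_near: "\<And>x. x \<in> F \<Longrightarrow> dist (f1 x) (f x) < \<delta> / 2"
    by (rule contraction_exists[OF f F half_gt_zero[OF \<delta>]]) (rule that)
  have f1_C: "f1 \<in> C_omega \<omega>"
    unfolding C_omega_iff
  proof (intro allI)
    fix x y
    show "dist (f1 x) (f1 y) \<le> \<omega> (dist x y)"
      using f1[of x y] mult_right_mono[of "1 - t" 1 "\<omega> (dist x y)"] nonneg[of "dist x y"] t by simp
  qed
  \<comment> \<open>The bound \<open>t * L\<close> keeps the diameter of the range of
    \<open>f1\<close> at most \<open>L - \<eta>\<close>; the bound \<open>\<epsilon> / 3\<close>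
    keeps the final loss \<open>2 * \<eta>\<close> below \<open>\<epsilon>\<close>.\<close>
  define \<eta> where "\<eta> = min (t * L) (\<epsilon> / 3)"
  have \<eta>: "0 < \<eta>" "\<eta> \<le> t * L" "2 * \<eta> < \<epsilon>" "\<eta> \<le> \<epsilon> / 3"
    using t L0 \<epsilon> by (auto simp: \<eta>_def)
  have diam: "dist (f1 x) (f1 y) \<le> (1 - t) * L" for x y
    using order_trans[OF f1[of x y] mult_left_mono[OF L[OF zero_le_dist]]] t by simp
  have le: "(1 - t) * L \<le> L - \<eta>" using \<eta> by (simp add: algebra_simps)
  obtain w where w: "\<And>x. dist (f1 x) w \<le> L - \<eta>"
    and w_far: "\<And>\<eta>'. 0 < \<eta>' \<Longrightarrow> \<exists>x. (L - \<eta>) - \<eta>' < dist (f1 x) w"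
    using farthest_distance_exists[of f1, OF diam le] by blast
  obtain x0 where x0: "L - 2 * \<eta> < dist (f1 x0) w"
    using w_far[OF \<eta>(1)] by (auto simp: algebra_simps)
  obtain c where c: "0 < c" "\<And>x. x \<in> F \<Longrightarrow> dist x x0 < 1 / c"
      "\<And>x. x \<in> F \<Longrightarrow> dist (taper c x0 f1 x) (f1 x) < \<delta> / 2"
    by (rule taper_param_exists[OF F half_gt_zero[OF \<delta>], of x0 f1]) (rule that)
  define h where "h = taper c x0 f1"
  have h: "h \<in> C_omega \<omega>"
    unfolding h_def using taper_in_C_omega[OF f1_C c(1)] .
  have far: "h x = f1 x0" if "1 / c \<le> dist x x0" for x
    unfolding h_def using taper_far[OF c(1) that] .
  \<comment> \<open>The choice of \<open>x0\<close> makes the geodesic to \<open>w\<close> longer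
    than \<open>L - 2 * \<eta>\<close>, so the bump fits; the maximum covers a negative
    \<open>L - 2 * \<eta>\<close>.\<close>
  define T where "T = max 0 (min (\<omega> s) (L - 2 * \<eta>))"
  have T: "0 \<le> T" "T \<le> dist (f1 x0) w" "T \<le> \<omega> s" "\<omega> s - \<epsilon> < T"
    using x0 pos L[OF s] \<eta> by (auto simp: T_def)
  have "\<exists>r\<in>{0..}. L - \<eta> < \<omega> r"
    using less_cSUP_iff[OF _ bdd, of "L - \<eta>"] \<eta> by (auto simp: L_def)
  then obtain r where r: "0 \<le> r" "L - \<eta> \<le> \<omega> r" by force
  \<comment> \<open>Values of \<open>h\<close> lie on geodesics between values of \<open>f1\<close>,
    hence within \<open>L - \<eta>\<close> of both \<open>f1 x0\<close> and \<open>w\<close>, and so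
    of the whole geodesic joining these.\<close>
  have B: "dist (h x) (geo (f1 x0) w \<tau>) \<le> L - \<eta>" if "0 \<le> \<tau>" "\<tau> \<le> T" for x \<tau>
  proof (rule dist_geo_le_bound)
    have "dist (f1 x0) (h x) \<le> L - \<eta>"
      unfolding h_def using c order_trans[OF diam le] by (intro dist_taper_le_bound)
    then show "dist (h x) (f1 x0) \<le> L - \<eta>" by (simp add: dist_commute)
    have "dist w (h x) \<le> L - \<eta>"
      unfolding h_def using c w by (intro dist_taper_le_bound) (auto simp: dist_commute)
    then show "dist (h x) w \<le> L - \<eta>" by (simp add: dist_commute)
  qed (use that T in auto)
  obtain g u v where g: "g \<in> C_omega \<omega>" "\<And>x. dist x x0 < 1 / c \<Longrightarrow> g x = h x"
    "dist u v = s" "dist (g u) (g v) = T"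
    by (rule bump_exists[where R = "1 / c" and ?x0.0 = x0, OF h far s T(1-3) B r])
      (assumption | rule that)+
  have "dist (g x) (f x) < \<delta>" if "x \<in> F" for x
    using c(2,3)[OF that] f1_near[OF that] g(2)[of x] dist_triangle[of "g x" "f x" "f1 x"]
    by (simp add: h_def)
  then show thesis
    using that[of g u v] g T by simp
qed

lemma perturbation_exists:
  fixes f :: "'a \<Rightarrow> 'a"
  assumes "0 < \<omega> s" "f \<in> C_omega \<omega>" "finite F" "0 < \<delta>" "0 \<le> s" "0 < \<epsilon>"
  obtains g u v where "g \<in> C_omega \<omega>" "\<And>x. x \<in> F \<Longrightarrow> dist (g x) (f x) < \<delta>"
    "dist u v \<le> s" "\<omega> s - \<epsilon> < dist (g u) (g v)"
proof (cases "bdd_above (\<omega> ` {0..})")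
  case True
  show thesis
    by (rule perturbation_bounded[OF True assms]) (rule that)
next
  case False
  have "\<exists>r\<ge>0. b \<le> \<omega> r" for b
  proof (rule ccontr)
    assume "\<not> ?thesis"
    then have "bdd_above (\<omega> ` {0..})"
      by (intro bdd_aboveI2[of _ _ b]) force
    then show False using False by blast
  qed
  then obtain g u v where "g \<in> C_omega \<omega>" "\<And>x. x \<in> F \<Longrightarrow> dist (g x) (f x) < \<delta>"
    "dist u v \<le> s" "\<omega> s \<le> dist (g u) (g v)"
    using perturbation_unbounded[of f F \<delta> s] assms by metis
  then show thesis
    using that[of g u v] assms by simp
qed

section \<open>The exceptional sets are closed and nowhere dense\<close>

definition deficient :: "real \<Rightarrow> real \<Rightarrow> ('a \<Rightarrow> 'a) set" where
  "deficient s \<epsilon> = {f \<in> C_omega \<omega>. \<forall>x y. dist x y \<le> s \<longrightarrow> dist (f x) (f y) \<le> \<omega> s - \<epsilon>}"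

lemma closedin_deficient:
  "closedin (subtopology pointwise_top (C_omega \<omega>)) (deficient s \<epsilon>)"
proof -
  have eq: "deficient s \<epsilon> = C_omega \<omega> \<inter>
      (\<Inter>x. \<Inter>y\<in>{y. dist x y \<le> s}. {f. dist (f x) (f y) \<le> \<omega> s - \<epsilon>})"
    by (auto simp: deficient_def)
  have "closed {f :: 'a \<Rightarrow> 'a. dist (f x) (f y) \<le> \<omega> s - \<epsilon>}" for x y
    by (intro closed_Collect_le continuous_intros continuous_on_product_coordinates)
  then show ?thesis
    unfolding eq pointwise_top_def euclidean_product_topology
    by (intro closedin_closed_Int closed_INT ballI) auto
qed

text \<open>A basic neighbourhood for pointwise convergence restricts only finitely many values, so
  it contains a perturbation that leaves the closed set.\<close>

lemma nowhere_dense_deficient: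
  assumes "0 < \<omega> s" "0 \<le> s" "0 < \<epsilon>"
  shows "nowhere_dense_in (subtopology pointwise_top (C_omega \<omega>)) (deficient s \<epsilon>)"
proof -
  let ?T = "subtopology pointwise_top (C_omega \<omega> :: ('a \<Rightarrow> 'a) set)"
  have "f \<notin> ?T interior_of (deficient s \<epsilon>)" for f
  proof
    assume "f \<in> ?T interior_of (deficient s \<epsilon>)"
    then obtain U where U: "openin pointwise_top U" "f \<in> U" "f \<in> C_omega \<omega>"
        "U \<inter> C_omega \<omega> \<subseteq> deficient s \<epsilon>"
      unfolding interior_of_def openin_subtopology by auto
    obtain X where X: "f \<in> Pi\<^sub>E UNIV X" "\<And>i. open (X i)" "finite {i. X i \<noteq> UNIV}"
        "Pi\<^sub>E UNIV X \<subseteq> U"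
      using product_topology_open_contains_basis[OF U(1)[unfolded pointwise_top_def] U(2)] by auto
    define F where "F = {i. X i \<noteq> UNIV}"
    have "\<forall>i. \<exists>e>0. ball (f i) e \<subseteq> X i"
      using X by (auto simp: open_contains_ball PiE_iff)
    then obtain e where e: "\<And>i. 0 < e i" "\<And>i. ball (f i) (e i) \<subseteq> X i" by metis
    \<comment> \<open>The extra \<open>1\<close> keeps the minimum meaningful when \<open>F\<close>
      is empty.\<close>
    define \<delta> where "\<delta> = Min (insert 1 (e ` F))"
    have \<delta>: "0 < \<delta>" "\<And>i. i \<in> F \<Longrightarrow> \<delta> \<le> e i"
      using X(3) e by (auto simp: \<delta>_def F_def)
    obtain g u v where g: "g \<in> C_omega \<omega>" "\<And>x. x \<in> F \<Longrightarrow> dist (g x) (f x) < \<delta>"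
      "dist u v \<le> s" "\<omega> s - \<epsilon> < dist (g u) (g v)"
      by (rule perturbation_exists[OF assms(1) U(3) X(3)[folded F_def] \<delta>(1) assms(2,3)]) (rule that)
    have "g i \<in> X i" for i
    proof (cases "i \<in> F")
      case True
      then have "g i \<in> ball (f i) (e i)"
        using g(2)[of i] \<delta>(2)[of i] by (simp add: dist_commute)
      then show ?thesis using e by blast
    qed (simp add: F_def)
    then have "g \<in> deficient s \<epsilon>"
      using X(4) U(4) g(1) by (auto simp: PiE_iff)
    then show False
      using g(3,4) unfolding deficient_def by force
  qed
  moreover have "?T closure_of (deficient s \<epsilon>) = deficient s \<epsilon>"
    using closedin_deficient by (simp add: closure_of_eq)
  ultimately show ?thesis
    using closedin_subset[OF closedin_deficient] by (auto simp: nowhere_dense_in_def)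
qed

section \<open>Recovering the modulus from countably many conditions\<close>

lemma modulus_cont_ge_if_not_deficient:
  assumes f: "f \<in> C_omega \<omega>" and n: "\<And>k :: nat. f \<notin> deficient s (1 / real (Suc k))"
  shows "ereal (\<omega> s) \<le> modulus_cont f s"
proof (rule ereal_le_epsilon2)
  fix e :: real assume "0 < e"
  then obtain k where k: "1 / real (Suc k) < e"
    using nat_approx_posE by blast
  obtain x y where "dist x y \<le> s" "\<omega> s - 1 / real (Suc k) < dist (f x) (f y)"
    using n[of k] f by (auto simp: deficient_def not_le)
  then have "ereal (\<omega> s - e) \<le> ereal (dist (f x) (f y))" "ereal (dist (f x) (f y)) \<le> modulus_cont f s"
    using k unfolding modulus_cont_def by (auto intro: SUP_upper2[of "(x, y)"])
  then have "ereal (\<omega> s - e) \<le> modulus_cont f s" by (rule order_trans)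
  then show "ereal (\<omega> s) \<le> modulus_cont f s + ereal e"
    by (cases "modulus_cont f s") auto
qed

text \<open>A meagre set can absorb the exceptions for countably many \<open>s\<close>. The slope
  inequality and monotonicity of the modulus pass from rationals just below \<open>s\<close> to
  \<open>s\<close> itself.\<close>

lemma modulus_cont_ge_if_rational:
  assumes f: "\<And>q. q \<in> \<rat> \<Longrightarrow> 0 < q \<Longrightarrow> ereal (\<omega> q) \<le> modulus_cont f q" and s: "0 < s"
  shows "ereal (\<omega> s) \<le> modulus_cont (f :: 'a \<Rightarrow> 'a) s"
proof (rule ccontr)
  assume "\<not> ?thesis"
  then obtain c where c: "modulus_cont f s \<le> ereal c" "c < \<omega> s"
    using ereal_dense2[of "modulus_cont f s" "ereal (\<omega> s)"] by force
  have q: "\<omega> q \<le> c" if "q \<in> \<rat>" "0 < q" "q \<le> s" for q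
    using order_trans[OF order_trans[OF f[OF that(1,2)] modulus_cont_mono[OF that(3)]] c(1)] by simp
  obtain q0 where "q0 \<in> \<rat>" "0 < q0" "q0 < s"
    using Rats_dense_in_real[OF s] by blast
  then have c0: "0 \<le> c" using q[of q0] nonneg[of q0] by simp
  then have pos: "0 < \<omega> s" using c by simp
  \<comment> \<open>For \<open>q1\<close> above this threshold, decreasing slopes give
    \<open>\<omega> q1 > c\<close>, contradicting \<open>q\<close>.\<close>
  have "c * s / \<omega> s < s"
    using pos c s by (simp add: field_simps)
  then obtain q1 where q1: "q1 \<in> \<rat>" "c * s / \<omega> s < q1" "q1 < s"
    using Rats_dense_in_real by blast
  moreover have "0 \<le> c * s / \<omega> s" using c0 s pos by simp
  ultimately have "0 < q1" by linarith
  then have "q1 * \<omega> s \<le> s * c"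
    using order_trans[OF slope_decreasing[of q1 s] mult_left_mono[OF q]] q1 s by simp
  then show False
    using q1 pos by (simp add: field_simps)
qed

end

theorem theorem5p2:
  fixes \<omega> :: "real \<Rightarrow> real"
  assumes complete: "complete (UNIV :: 'a::metric_space set)"
    and separable: "\<exists>D::'a set. countable D \<and> closure D = UNIV"
    and unbounded: "\<not> bounded (UNIV :: 'a set)"
    and hyp: "hyperbolic_space TYPE('a)"
    and om_nonneg: "\<forall>s\<ge>0. \<omega> s \<ge> 0"
    and om_cont: "continuous_on {0..} \<omega>"
    and om_concave: "concave_on {0..} \<omega>"
    and om_nonzero: "\<exists>s\<ge>0. \<omega> s \<noteq> 0"
    and om_mono: "mono_on {0..} \<omega>"
    and om_zero: "\<omega> 0 = 0"
  shows "\<exists>M. meagre_in (subtopology pointwise_top (C_omega \<omega> :: ('a \<Rightarrow> 'a) set)) M \<and>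
             (\<forall>f \<in> C_omega \<omega> - M. \<forall>s\<ge>0. modulus_cont f s = ereal (\<omega> s))"
proof -
  obtain geo :: "'a \<Rightarrow> 'a \<Rightarrow> real \<Rightarrow> 'a" where "coherent_geodesics geo" "hyperbolic_geo geo"
    using hyp unfolding hyperbolic_space_def by blast
  then interpret hyperbolic_modulus \<omega> geo
    using assms by unfold_locales (auto simp: mono_on_def)
  \<comment> \<open>Positivity at one point spreads to the right by monotonicity and to the left by
    decreasing slopes.\<close>
  have pos: "0 < \<omega> s" if "0 < s" for s
  proof -
    obtain r where r: "0 \<le> r" "\<omega> r \<noteq> 0" using om_nonzero by blast
    then have "0 < \<omega> r" "0 < r"
      using nonneg[of r] zero by (auto simp: less_le)
    show ?thesis
    proof (cases "r \<le> s")
      case True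
      then show ?thesis using mono[of r s] \<open>0 < \<omega> r\<close> r by simp
    next
      case False
      then have "s * \<omega> r \<le> r * \<omega> s" using slope_decreasing[of s r] that by simp
      moreover have "0 < s * \<omega> r" using \<open>0 < \<omega> r\<close> that by simp
      ultimately show ?thesis
        using \<open>0 < r\<close> by (meson less_le_trans zero_less_mult_pos)
    qed
  qed
  define N where "N = (\<lambda>(q, k). deficient q (1 / real (Suc k))) ` ((\<rat> \<inter> {0<..}) \<times> UNIV)"
  have "countable N"
    unfolding N_def by (intro countable_image countable_SIGMA countable_Int1 countable_rat) auto
  moreover have "nowhere_dense_in (subtopology pointwise_top (C_omega \<omega>)) S" if "S \<in> N" for S
    using that pos by (auto simp: N_def intro!: nowhere_dense_deficient)
  ultimately have "meagre_in (subtopology pointwise_top (C_omega \<omega>)) (\<Union>N)"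
    unfolding meagre_in_def nowhere_dense_in_def by blast
  moreover have "modulus_cont f s = ereal (\<omega> s)"
    if f: "f \<in> C_omega \<omega> - \<Union>N" and s: "0 \<le> s" for f s
  proof (rule antisym)
    show "modulus_cont f s \<le> ereal (\<omega> s)"
      using f s by (simp add: C_omega_def)
    show "ereal (\<omega> s) \<le> modulus_cont f s"
    \<comment> \<open>\<open>N\<close> covers positive \<open>s\<close> only; at \<open>0\<close> a
      pair of equal points already gives the bound.\<close>
    proof (cases "s = 0")
      case True
      have "ereal (dist (f undefined) (f undefined)) \<le> modulus_cont f 0"
        unfolding modulus_cont_def by (rule SUP_upper2[of "(undefined, undefined)"]) auto
      then show ?thesis using True zero by simp
    next
      case False
      show ?thesis
      proof (rule modulus_cont_ge_if_rational)
        fix q :: real assume "q \<in> \<rat>" "0 < q"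
        then show "ereal (\<omega> q) \<le> modulus_cont f q"
          using f by (intro modulus_cont_ge_if_not_deficient) (auto simp: N_def)
      qed (use s False in simp)
    qed
  qed
  ultimately show ?thesis by blast
qed

end
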